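(* Let $G$ be a homogeneous competition game. Let $\delta^*$ be the smallest real number $\delta$ for which there is a partition $P$ such that $(P,(\delta,\delta,\ldots,\delta))$ is a PSPE of $G$, let $\boldsymbol\delta^*=(\delta^*,\ldots,\delta^* )$, and let $P^*$ be a partition such that $(P^*,\boldsymbol\delta^* )$ is a PSPE of $G$. Then $(P^*,\boldsymbol\delta^* )$ is a coalition-proof subgame perfect equilibrium (CP-PSPE) of $G$.
   Context: Competition game: $N$ is a finite set of workers, $K$ a finite set of $k\ge 2$ firms, and each firm $i\in K$ has a nondecreasing value function $v_i:2^N\to\mathbb R_+$ with $v_i(\emptyset)=0$. In step 1 all firms simultaneously choose payment policies $\mathbf x_i=(x_{ij})_{j\in N}\in\mathbb R^N$ (payments may be negative). In step 2 each worker chooses a firm or stays idle. An outcome is a pair $(P,\mathbf X)$ where $\mathbf X=(x_{ij})$ and $P=(S_0,(S_i)_{i\in K})$ is a partition of $N$ ($S_0$ = idle workers; parts may be empty). Put $x_{0j}=0$. A worker $j\in S_i$ receives $\hat x_j=x_{ij}$; firm $i$ has profit $r_i(P,\mathbf X)=v_i(S_i)-\sum_{j\in S_i}x_{ij}$. PSPE: let $\mathcal P(\mathbf X)$ be the set of partitions such that every worker $j\in S_i$ ($i\in K\cup\{0\}$) satisfies $x_{ij}=\max_{i'\in K\cup\{0\}}x_{i'j}$. A tie-breaking rule is a map $\mathbf X\mapsto P(\mathbf X)\in\mathcal P(\mathbf X)$. An outcome $(P,\mathbf X)$ is a pure subgame perfect equilibrium (PSPE) if for some tie-breaking rule: (a)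 $P=P(\mathbf X)$; and (b) for every $i\in K$ and every policy $\mathbf x_i'$, $r_i(P',\mathbf X')\le r_i(P,\mathbf X)$, where $\mathbf X'=(\mathbf x_{-i},\mathbf x_i')$ and $P'=P(\mathbf X')$. For $\mathbf x\in\mathbb R^N$, the outcome $(P,\mathbf x)$ denotes the outcome $(P,\mathbf X)$ in which every firm offers $x_{ij}=x_j$ to each worker $j$, where $x_j=\hat x_j$ is the realized payment (so $x_j=0$ for idle workers). Homogeneous game: $v_i(S)=v_i(|S|)$ for a nondecreasing function $v_i:\{0,1,\ldots,n\}\to\mathbb R_+$ with $v_i(0)=0$ and nonincreasing marginals $v_i(t+1)-v_i(t)$ (standing submodularity assumption); $n=|N|$. It is known (Kelso and Crawford) that a homogeneous game has a PSPE, and that it then has one of the form $(P,(\delta,\ldots,\delta))$. CP-PSPE: an outcome $(P,\mathbf X)$ is a CP-PSPE if, for some tie-breaking rule $P(\cdot)$ (used throughout): (a) $(P,\mathbf X)$ is a PSPE with respect to this rule; and (b) the following holds for every coalition $R=K'\cup N'$ with $K'\subseteq K$, $N'\subseteq N$, and every joint deviation of $R$ consisting of policies $\mathbf z_{K'}$ of the firms in $K'$ and choices $Q_{N'}$ (of a firm or of staying idle) of the workers in $N'$. Let $\mathbf Z=(\mathbf x_{-K'},\mathbf z_{K'})$ and let $Q$ be the partition in which workers of $N'$ choose according to $Q_{N'}$ and all other workers choose as in $P(\mathbf Z)$. If all members of the (nonempty) coalition $R$ are strictly better off in $(Q,\mathbf Z)$ than in $(P,\mathbf X)$, then some agent $g\in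 R$ (a firm or a worker) can strictly gain by deviating alone from $(Q,\mathbf Z)$ to another strategy. (When a firm in $R$ so re-deviates, the workers in $N'$ keep their choices $Q_{N'}$ and the remaining workers choose according to $P(\cdot)$ at the new offers.) *)

theory Defs
  imports Complex_Main "HOL-Library.Cardinality"
begin

(* The finite sets N of workers and K of firms are the universes of the finite types 'w and 'f. *)

type_synonym ('f, 'w) valuation = "'f \<Rightarrow> 'w set \<Rightarrow> real"

(* Payment matrix X: X i j is what firm i offers to worker j. *)
type_synonym ('f, 'w) offers = "'f \<Rightarrow> 'w \<Rightarrow> real"

(* A partition (S_0, (S_i)) of the workers is given by its choice function: worker j is in S_i iff
   P j = Some i, and in S_0 (idle) iff P j = None. Parts may be empty. *)
type_synonym ('f, 'w) assignment = "'w \<Rightarrow> 'f option"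

definition competition_game :: "('f::finite, 'w::finite) valuation \<Rightarrow> bool" where
  "competition_game v \<longleftrightarrow>
     CARD('f) \<ge> 2 \<and>
     (\<forall>i. v i {} = 0 \<and> mono (v i) \<and> (\<forall>S. 0 \<le> v i S))"

definition homogeneous_game :: "('f::finite, 'w::finite) valuation \<Rightarrow> bool" where
  "homogeneous_game v \<longleftrightarrow>
     competition_game v \<and>
     (\<exists>u :: 'f \<Rightarrow> nat \<Rightarrow> real. \<forall>i.
        (\<forall>S. v i S = u i (card S)) \<and>
        u i 0 = 0 \<and>
        (\<forall>t \<in> {0..CARD('w)}. 0 \<le> u i t) \<and>
        mono_on {0..CARD('w)} (u i) \<and>
        (\<forall>t. t + 2 \<le> CARD('w) \<longrightarrow> u i (t + 2) - u i (t + 1) \<le> u i (t + 1) - u i t))"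

(* The None case is the convention x_{0j} = 0. *)
definition offer :: "('f, 'w) offers \<Rightarrow> 'f option \<Rightarrow> 'w \<Rightarrow> real" where
  "offer X c j = (case c of None \<Rightarrow> 0 | Some i \<Rightarrow> X i j)"

definition payment :: "('f, 'w) assignment \<Rightarrow> ('f, 'w) offers \<Rightarrow> 'w \<Rightarrow> real" where
  "payment P X j = offer X (P j) j"

definition hired :: "('f, 'w) assignment \<Rightarrow> 'f \<Rightarrow> 'w set" where
  "hired P i = {j. P j = Some i}"

definition profit ::
    "('f, 'w) valuation \<Rightarrow> 'f \<Rightarrow> ('f, 'w) assignment \<Rightarrow> ('f, 'w) offers \<Rightarrow> real" where
  "profit v i P X = v i (hired P i) - (\<Sum>j\<in>hired P i. X i j)"

definition best_assignments :: "('f::finite, 'w) offers \<Rightarrow> ('f, 'w) assignment set" where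
  "best_assignments X = {P. \<forall>j. offer X (P j) j = Max (range (\<lambda>c. offer X c j))}"

definition tie_breaking_rule ::
    "(('f::finite, 'w) offers \<Rightarrow> ('f, 'w) assignment) \<Rightarrow> bool" where
  "tie_breaking_rule T \<longleftrightarrow> (\<forall>X. T X \<in> best_assignments X)"

definition pspe_wrt ::
    "('f::finite, 'w::finite) valuation \<Rightarrow> (('f, 'w) offers \<Rightarrow> ('f, 'w) assignment) \<Rightarrow>
     ('f, 'w) assignment \<Rightarrow> ('f, 'w) offers \<Rightarrow> bool" where
  "pspe_wrt v T P X \<longleftrightarrow>
     P = T X \<and>
     (\<forall>i x'. let X' = X(i := x') in profit v i (T X') X' \<le> profit v i P X)"

definition pspe ::
    "('f::finite, 'w::finite) valuation \<Rightarrow> ('f, 'w) assignment \<Rightarrow> ('f, 'w) offers \<Rightarrow> bool" where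
  "pspe v P X \<longleftrightarrow> (\<exists>T. tie_breaking_rule T \<and> pspe_wrt v T P X)"

definition uniform_offers :: "('w \<Rightarrow> real) \<Rightarrow> ('f, 'w) offers" where
  "uniform_offers x = (\<lambda>i j. x j)"

(* (P, x) is a PSPE, for a payment vector x. The notation (P, x) presupposes that x is the vector
   of realized payments, hence the first conjunct; in particular x j = 0 for idle j. *)
definition uniform_pspe ::
    "('f::finite, 'w::finite) valuation \<Rightarrow> ('f, 'w) assignment \<Rightarrow> ('w \<Rightarrow> real) \<Rightarrow> bool" where
  "uniform_pspe v P x \<longleftrightarrow>
     (\<forall>j. x j = payment P (uniform_offers x) j) \<and> pspe v P (uniform_offers x)"

(* The coalition consists of the firms K' and the workers N'. At offers Z the workers in N' choose
   according to q and all others according to T; only the values of q on N' matter. A firm that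
   re-deviates faces the choices q of N' unchanged, while T is applied anew to the other workers. *)
definition member_gains ::
    "('f::finite, 'w::finite) valuation \<Rightarrow> (('f, 'w) offers \<Rightarrow> ('f, 'w) assignment) \<Rightarrow>
     'f set \<Rightarrow> 'w set \<Rightarrow> ('f, 'w) assignment \<Rightarrow> ('f, 'w) offers \<Rightarrow> bool" where
  "member_gains v T K' N' q Z \<longleftrightarrow>
     (let Q = override_on (T Z) q N' in
       (\<exists>i\<in>K'. \<exists>z'. let Z' = Z(i := z') in
          profit v i (override_on (T Z') q N') Z' > profit v i Q Z) \<or>
       (\<exists>j\<in>N'. \<exists>c. payment (Q(j := c)) Z j > payment Q Z j))"

definition cp_pspe ::
    "('f::finite, 'w::finite) valuation \<Rightarrow> ('f, 'w) assignment \<Rightarrow> ('f, 'w) offers \<Rightarrow> bool" where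
  "cp_pspe v P X \<longleftrightarrow>
     (\<exists>T. tie_breaking_rule T \<and> pspe_wrt v T P X \<and>
       (\<forall>K' N' z q.
          let Z = override_on X z K'; Q = override_on (T Z) q N' in
            (K' \<noteq> {} \<or> N' \<noteq> {}) \<and>
            (\<forall>i\<in>K'. profit v i Q Z > profit v i P X) \<and>
            (\<forall>j\<in>N'. payment Q Z j > payment P X j) \<longrightarrow>
            member_gains v T K' N' q Z))"

end

theory Submission
  imports Defs
begin

text \<open>
  In a PSPE every firm's profit is at least what any set of workers would bring it at the realized
  payments: it can poach any set by overbidding by an arbitrarily small amount. Consider a coalition
  whose deviation is profitable and self-enforcing. It contains no workers, since the firm employing
  one could cut his pay and keep him. It contains all firms, since the offers of a non-member would
  keep all payments at least \<open>\<delta>\<^sup>*\<close>. Hence the deviation is a PSPE in which every firm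
  hires someone at less than \<open>\<delta>\<^sup>*\<close>. A firm never employs a worker who costs more than
  one it does not employ, so two active firms force all payments to be equal, and the
  deviation yields a uniform PSPE with a smaller payment than \<open>\<delta>\<^sup>*\<close>.
\<close>

section \<open>Best responses of workers and tie-breaking rules\<close>

lemma best_assignments_iff:
  fixes X :: "('f::finite, 'w) offers"
  shows "P \<in> best_assignments X \<longleftrightarrow> (\<forall>j c. offer X c j \<le> offer X (P j) j)"
proof -
  have "offer X (P j) j = Max (range (\<lambda>c. offer X c j)) \<longleftrightarrow> (\<forall>c. offer X c j \<le> offer X (P j) j)"
    for j
    by (subst eq_commute, subst Max_eq_iff) auto
  then show ?thesis
    by (auto simp: best_assignments_def)
qed

lemma tie_breaking_rule_offer_le:
  assumes "tie_breaking_rule T"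
  shows "offer X c j \<le> offer X (T X j) j"
  using assms by (auto simp: tie_breaking_rule_def best_assignments_iff)

lemma best_assignments_nonempty:
  fixes X :: "('f::finite, 'w) offers"
  shows "best_assignments X \<noteq> {}"
proof -
  have "\<exists>c. offer X c j = Max (range (\<lambda>c. offer X c j))" for j
    using Max_in[of "range (\<lambda>c. offer X c j)"] by (metis UNIV_not_empty finite finite_imageI image_is_empty rangeE)
  then obtain P where "\<forall>j. offer X (P j) j = Max (range (\<lambda>c. offer X c j))"
    by metis
  then show ?thesis
    by (auto simp: best_assignments_def)
qed

lemma tie_breaking_rule_through:
  fixes X :: "('f::finite, 'w) offers"
  assumes "P \<in> best_assignments X"
  obtains T where "tie_breaking_rule T" "T X = P"
proof
  let ?T = "(\<lambda>Y. SOME Q. Q \<in> best_assignments Y)(X := P)"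
  show "tie_breaking_rule ?T"
    using assms best_assignments_nonempty by (auto simp: tie_breaking_rule_def some_in_eq)
qed simp

lemma offer_simps [simp]: "offer X None j = 0" "offer X (Some i) j = X i j"
  by (simp_all add: offer_def)

section \<open>Competitive properties of equilibrium payments\<close>

lemma profit_eq_payment: "profit v i P X = v i (hired P i) - (\<Sum>j\<in>hired P i. payment P X j)"
  by (simp add: profit_def payment_def hired_def)

lemma payment_nonneg: "tie_breaking_rule T \<Longrightarrow> 0 \<le> payment (T X) X j"
  using tie_breaking_rule_offer_le[of T X None j] by (simp add: payment_def)

text \<open>Workers in \<open>N'\<close> are committed to \<open>q\<close>, so their pay \<open>b\<close> is arbitrary;
  the others must be poached by overbidding.\<close>

lemma poaching_bound:
  fixes v :: "('f::finite, 'w::finite) valuation"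
  assumes T: "tie_breaking_rule T"
    and no_gain: "\<And>z. profit v i (override_on (T (X(i := z))) q N') (X(i := z)) \<le> r"
    and committed: "\<And>j. j \<in> N' \<Longrightarrow> q j = Some i \<longleftrightarrow> j \<in> S"
    and overbid: "\<And>j c. j \<in> S \<Longrightarrow> j \<notin> N' \<Longrightarrow> c \<noteq> Some i \<Longrightarrow> offer X c j \<le> b j"
  shows "v i S - (\<Sum>j\<in>S. b j) \<le> r"
proof -
  have *: "v i S - (\<Sum>j\<in>S. b j) - e * card S \<le> r" if "e > 0" for e :: real
  proof -
    \<comment> \<open>Idleness beats \<open>-1\<close>, so uncommitted workers outside
      \<open>S\<close> stay away; the surplus \<open>e\<close> makes the bid strictly best for those
      in \<open>S\<close>, however \<open>T\<close> breaks ties.\<close>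
    define z where "z j = (if j \<in> S then b j + e else -1)" for j
    let ?X = "X(i := z)"
    have "T ?X j = Some i \<longleftrightarrow> j \<in> S" if "j \<notin> N'" for j
    proof
      assume "T ?X j = Some i"
      then have "0 \<le> z j"
        using tie_breaking_rule_offer_le[OF T, of ?X None j] by simp
      then show "j \<in> S"
        by (auto simp: z_def split: if_splits)
    next
      assume "j \<in> S"
      show "T ?X j = Some i"
      proof (rule ccontr)
        assume neq: "T ?X j \<noteq> Some i"
        then have "offer ?X (T ?X j) j = offer X (T ?X j) j"
          by (cases "T ?X j") auto
        also have "\<dots> \<le> b j"
          using overbid neq \<open>j \<in> S\<close> that by blast
        also have "\<dots> < offer ?X (Some i) j"
          using \<open>j \<in> S\<close> \<open>e > 0\<close> by (simp add: z_def)
        finally show False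
          using tie_breaking_rule_offer_le[OF T, of ?X "Some i" j] by simp
      qed
    qed
    then have "hired (override_on (T ?X) q N') i = S"
      using committed by (auto simp: hired_def override_on_def)
    then have "profit v i (override_on (T ?X) q N') ?X = v i S - (\<Sum>j\<in>S. b j + e)"
      by (simp add: profit_def z_def)
    then show ?thesis
      using no_gain[of z] by (simp add: sum.distrib algebra_simps)
  qed
  show ?thesis
  proof (rule field_le_epsilon)
    fix e :: real
    assume "e > 0"
    \<comment> \<open>Spreads the error over the workers of \<open>S\<close>; the \<open>+ 1\<close>
      covers empty \<open>S\<close>.\<close>
    have "e / (real (card S) + 1) * card S \<le> e"
      using \<open>e > 0\<close> by (simp add: field_simps)
    then show "v i S - (\<Sum>j\<in>S. b j) \<le> r + e"
      using *[of "e / (real (card S) + 1)"] \<open>e > 0\<close> by (simp add: add_pos_nonneg)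
  qed
qed

text \<open>Poaching with nobody committed: the realized payments are the highest offers, so
  overbidding them slightly attracts any \<open>S\<close>.\<close>

lemma pspe_wrt_competitive:
  fixes v :: "('f::finite, 'w::finite) valuation"
  assumes "tie_breaking_rule T" "pspe_wrt v T P X"
  shows "v i S - (\<Sum>j\<in>S. payment P X j) \<le> profit v i P X"
proof (rule poaching_bound[OF assms(1), where N' = "{}"])
  show "profit v i (override_on (T (X(i := z))) q {}) (X(i := z)) \<le> profit v i P X" for z q
    using assms(2) unfolding pspe_wrt_def Let_def override_on_emptyset by blast
  show "offer X c j \<le> payment P X j" for c j
    using assms tie_breaking_rule_offer_le[of T X c j] by (simp add: pspe_wrt_def payment_def)
qed auto

text \<open>A converse to \<open>pspe_wrt_competitive\<close> at uniform pay. Whatever one firm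
  offers, a second firm still offers \<open>\<delta>\<close>, so every worker hired by the deviator
  costs at least \<open>\<delta>\<close>. Hence the tie-breaking rule matters only at the uniform
  offers.\<close>

lemma uniform_pspeI:
  fixes v :: "('f::finite, 'w::finite) valuation"
  assumes two_firms: "CARD('f) \<ge> 2"
    and realized: "\<And>j. payment P (uniform_offers (\<lambda>_. \<delta>)) j = \<delta>"
    and nonneg: "0 \<le> \<delta>"
    and competitive: "\<And>i S. v i S - \<delta> * card S \<le> v i (hired P i) - \<delta> * card (hired P i)"
  shows "uniform_pspe v P (\<lambda>_. \<delta>)"
proof -
  let ?U = "uniform_offers (\<lambda>_. \<delta>) :: ('f, 'w) offers"
  have "offer ?U c j \<le> offer ?U (P j) j" for c j
    using realized[of j] nonneg
    by (cases c) (auto simp: uniform_offers_def payment_def)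
  then have "P \<in> best_assignments ?U"
    by (simp add: best_assignments_iff)
  then obtain T where T: "tie_breaking_rule T" "T ?U = P"
    by (rule tie_breaking_rule_through)
  have "profit v i (T (?U(i := x))) (?U(i := x)) \<le> profit v i P ?U" for i x
  proof -
    let ?X = "?U(i := x)" and ?S = "hired (T (?U(i := x))) i"
    have "UNIV \<noteq> {i}"
    proof
      assume "UNIV = {i}"
      then have "CARD('f) = card {i}"
        by (rule arg_cong)
      then show False
        using two_firms by simp
    qed
    then obtain i' where "i' \<noteq> i"
      by blast
    then have "\<delta> \<le> x j" if "j \<in> ?S" for j
      using tie_breaking_rule_offer_le[OF T(1), of ?X "Some i'" j] that
      by (simp add: hired_def uniform_offers_def)
    then have "(\<Sum>j\<in>?S. \<delta>) \<le> (\<Sum>j\<in>?S. x j)"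
      by (rule sum_mono)
    then have "profit v i (T ?X) ?X \<le> v i ?S - \<delta> * card ?S"
      by (simp add: profit_def mult.commute)
    also have "\<dots> \<le> profit v i P ?U"
      using competitive[of i ?S] by (simp add: profit_def uniform_offers_def mult.commute)
    finally show ?thesis .
  qed
  then show ?thesis
    using T realized by (auto simp: uniform_pspe_def pspe_def pspe_wrt_def)
qed

text \<open>Exchanging one worker for another does not change the value of a firm's workforce.\<close>

lemma homogeneous_competitive_swap:
  fixes v :: "('f::finite, 'w::finite) valuation"
  assumes "homogeneous_game v"
    and competitive: "\<And>S. v i S - (\<Sum>j\<in>S. y j) \<le> v i A - (\<Sum>j\<in>A. y j)"
    and "j \<in> A" "l \<notin> A"
  shows "y j \<le> y l"
proof -
  obtain u :: "nat \<Rightarrow> real" where u: "\<And>S. v i S = u (card S)"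
    using assms(1) unfolding homogeneous_game_def by metis
  let ?S = "insert l (A - {j})"
  have "card ?S = card A"
    using assms(3,4) card_Suc_Diff1[of A j] by (metis DiffD1 card_insert_disjoint finite)
  moreover have "(\<Sum>k\<in>?S. y k) = y l + ((\<Sum>k\<in>A. y k) - y j)"
    using assms(3,4) by (simp add: sum_diff1)
  ultimately show ?thesis
    using competitive[of ?S] by (simp add: u)
qed

section \<open>Coalitional deviations from the cheapest uniform equilibrium\<close>

theorem proposition4p6:
  fixes v :: "'f::finite \<Rightarrow> 'w::finite set \<Rightarrow> real"
    and \<delta>star :: real
    and Pstar :: "'w \<Rightarrow> 'f option"
  assumes "homogeneous_game v"
    and "\<exists>P. uniform_pspe v P (\<lambda>_. \<delta>star)"
    and "\<And>\<delta> P. uniform_pspe v P (\<lambda>_. \<delta>) \<Longrightarrow> \<delta>star \<le> \<delta>"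
    and "uniform_pspe v Pstar (\<lambda>_. \<delta>star)"
  shows "cp_pspe v Pstar (uniform_offers (\<lambda>_. \<delta>star))"
proof -
  let ?U = "uniform_offers (\<lambda>_. \<delta>star) :: ('f, 'w) offers"
  have two_firms: "CARD('f) \<ge> 2"
    using assms(1) by (simp add: homogeneous_game_def competition_game_def)
  obtain T where T: "tie_breaking_rule T" and star: "pspe_wrt v T Pstar ?U"
    using assms(4) by (auto simp: uniform_pspe_def pspe_def)
  have pay_star: "payment Pstar ?U j = \<delta>star" for j
    using assms(4) by (simp add: uniform_pspe_def)
  have nonneg: "0 \<le> \<delta>star"
    \<comment> \<open>\<open>undefined\<close> merely names some worker; the type is
      nonempty.\<close>
    using payment_nonneg[OF T, of ?U undefined] star pay_star[of undefined]
    by (simp add: pspe_wrt_def)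
  have star_ge: "v i S - \<delta>star * card S \<le> profit v i Pstar ?U" for i S
    using pspe_wrt_competitive[OF T star, of i S] by (simp add: pay_star mult.commute)
  have gains: "member_gains v T K' N' q Z"
    if Z: "Z = override_on ?U z K'" and Q: "Q = override_on (T Z) q N'"
      and coalition: "K' \<noteq> {} \<or> N' \<noteq> {}"
      and firms: "\<forall>i\<in>K'. profit v i Q Z > profit v i Pstar ?U"
      and workers: "\<forall>j\<in>N'. payment Q Z j > payment Pstar ?U j"
    for K' N' z q Z Q
  proof (rule ccontr)
    assume "\<not> member_gains v T K' N' q Z"
    then have no_gain: "profit v i (override_on (T (Z(i := x))) q N') (Z(i := x)) \<le> profit v i Q Z"
      if "i \<in> K'" for i x
      using that unfolding member_gains_def Let_def Q[symmetric] by (meson not_le)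
    have outside: "Z i j = \<delta>star" if "i \<notin> K'" for i j
      using that by (simp add: Z uniform_offers_def)
    have "N' = {}"
    proof (rule ccontr)
      assume "N' \<noteq> {}"
      then obtain j where j: "j \<in> N'"
        by blast
      then have paid: "payment Q Z j > \<delta>star"
        using workers by (simp add: pay_star)
      then obtain i where i: "Q j = Some i"
        using nonneg by (cases "Q j") (auto simp: payment_def)
      then have "i \<in> K'"
        using paid outside[of i j] by (cases "i \<in> K'") (auto simp: payment_def)
      let ?S = "hired Q i"
      \<comment> \<open>Firm \<open>i\<close> can keep its workforce while paying each committed
        worker 1 less; the others already receive their best offer from \<open>i\<close>, so an
        arbitrarily small raise holds them.\<close>
      have "v i ?S - (\<Sum>k\<in>?S. Z i k - of_bool (k \<in> N')) \<le> profit v i Q Z"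
      proof (rule poaching_bound[OF T no_gain])
        show "i \<in> K'" by fact
        show "q k = Some i \<longleftrightarrow> k \<in> ?S" if "k \<in> N'" for k
          using that by (simp add: Q hired_def)
        show "offer Z c k \<le> Z i k - of_bool (k \<in> N')" if "k \<in> ?S" "k \<notin> N'" for c k
          using that tie_breaking_rule_offer_le[OF T, of Z c k] by (simp add: Q hired_def)
      qed
      then have "(\<Sum>k\<in>?S. of_bool (k \<in> N') :: real) \<le> 0"
        by (simp add: profit_def sum_subtractf)
      moreover have "(\<Sum>k\<in>?S. of_bool (k \<in> N') :: real) > 0"
        using i j by (intro sum_pos2[of _ j]) (auto simp: hired_def)
      ultimately show False
        by simp
    qed
    then have Q_eq: "Q = T Z" and "K' \<noteq> {}"
      using Q coalition by auto
    have best: "offer Z c j \<le> payment Q Z j" for c j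
      using tie_breaking_rule_offer_le[OF T, of Z c j] by (simp add: Q_eq payment_def)
    \<comment> \<open>A firm paying all its workers at least \<open>\<delta>star\<close> earns no
      more than \<open>star_ge\<close> guarantees it before the deviation.\<close>
    have cheap: "\<exists>j\<in>hired Q i. payment Q Z j < \<delta>star" if "i \<in> K'" for i
    proof (rule ccontr)
      assume "\<not> ?thesis"
      then have "(\<Sum>j\<in>hired Q i. \<delta>star) \<le> (\<Sum>j\<in>hired Q i. payment Q Z j)"
        by (intro sum_mono) auto
      then have "profit v i Q Z \<le> v i (hired Q i) - \<delta>star * card (hired Q i)"
        by (simp add: profit_eq_payment mult.commute)
      then show False
        using star_ge[of i "hired Q i"] firms that by fastforce
    qed
    have K': "i \<in> K'" for i
    proof (rule ccontr)
      assume "i \<notin> K'"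
      then have "\<delta>star \<le> payment Q Z j" for j
        using best[of "Some i" j] by (simp add: outside)
      then show False
        using cheap \<open>K' \<noteq> {}\<close> by (meson ex_in_conv not_le)
    qed
    \<comment> \<open>With all firms and no workers in the coalition, the absence of a gaining
      member is exactly the equilibrium condition.\<close>
    have "pspe_wrt v T Q Z"
      using no_gain K' by (simp add: pspe_wrt_def Q_eq \<open>N' = {}\<close>)
    note competitive = pspe_wrt_competitive[OF T this]
    define y where "y = payment Q Z"
    have swap: "y j \<le> y l" if "Q j = Some i" "Q l \<noteq> Some i" for i j l
      using that competitive[of i] unfolding y_def
      by (intro homogeneous_competitive_swap[OF assms(1), where A = "hired Q i"])
        (auto simp: profit_eq_payment hired_def)
    have y_nonneg: "0 \<le> y j" for j
      using payment_nonneg[OF T] by (simp add: y_def Q_eq)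
    have y_idle: "y j = 0" if "Q j = None" for j
      using that by (simp add: y_def payment_def)
    obtain i i' :: 'f where "i \<noteq> i'"
      using two_firms card_le_Suc0_iff_eq[of "UNIV :: 'f set"] by fastforce
    obtain j where j: "Q j = Some i" "y j < \<delta>star"
      using cheap[OF K'[of i]] by (auto simp: y_def hired_def)
    obtain j' where j': "Q j' = Some i'"
      using cheap[OF K'[of i']] by (auto simp: hired_def)
    \<comment> \<open>An idle \<open>l\<close> forces both payments to 0. Two workers of firm
      \<open>i\<close> are compared through \<open>j'\<close> at the other firm; workers of
      different firms are swapped in both directions.\<close>
    have y_eq: "y l = y j" for l
    proof (cases "Q l")
      case None
      then show ?thesis
        using swap[of j i l] j y_idle[of l] y_nonneg[of j] by simp
    next
      case (Some i2)
      show ?thesis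
      proof (cases "i2 = i")
        case True
        then show ?thesis
          using swap[of j i j'] swap[of j' i' j] swap[of l i j'] swap[of j' i' l]
            Some j j' \<open>i \<noteq> i'\<close> by simp
      next
        case False
        then show ?thesis
          using swap[of j i l] swap[of l i2 j] Some j by simp
      qed
    qed
    then obtain \<delta> where \<delta>: "\<And>l. y l = \<delta>"
      by blast
    have "uniform_pspe v Q (\<lambda>_. \<delta>)"
    proof (rule uniform_pspeI[OF two_firms])
      \<comment> \<open>If some \<open>l\<close> is idle, its payment is 0 by convention, and then
        \<open>y_idle\<close> makes \<open>\<delta>\<close> equal to 0.\<close>
      show "payment Q (uniform_offers (\<lambda>_. \<delta>)) l = \<delta>" for l
        using y_idle[of l] \<delta>[of l]
        by (cases "Q l") (simp_all add: payment_def uniform_offers_def)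
      show "0 \<le> \<delta>"
        using y_nonneg[of j] by (simp add: \<delta>)
      show "v i S - \<delta> * card S \<le> v i (hired Q i) - \<delta> * card (hired Q i)" for i S
        using competitive[of i S]
        by (simp add: profit_eq_payment y_def[symmetric] \<delta> mult.commute)
    qed
    then show False
      using assms(3) j(2) \<delta>[of j] by fastforce
  qed
  then show ?thesis
    unfolding cp_pspe_def Let_def
    by (intro exI[of _ T] conjI allI impI T star) (elim conjE, rule gains[OF refl refl])
qed

end
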